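(* Let $U$ be a real $n\times n$ matrix which is the inverse of an $M$-matrix, and let $\alpha\ge 1$ be a real number. Let $U^{(\alpha)}$ be the matrix with entries $(U^{(\alpha)})_{ij}=(U_{ij})^{\alpha}$. Then $U^{(\alpha)}$ is the inverse of an $M$-matrix. If moreover $U$ is a potential, then $U^{(\alpha)}$ is a potential. If moreover $U$ is a bi-potential, then $U^{(\alpha)}$ is a bi-potential.
   Context: All matrices are real and square; inequalities are entrywise; $'$ denotes transpose. An $M$-matrix here means a nonsingular matrix with nonpositive off-diagonal entries whose inverse is entrywise nonnegative. A nonnegative matrix $U$ is a potential if it is nonsingular and $(U^{-1})_{ij}\le 0$ for $i\ne j$, $(U^{-1})_{ii}>0$, and $\sum_j (U^{-1})_{ij}\ge 0$ for every $i$. It is a bi-potential if in addition $\sum_i (U^{-1})_{ij}\ge 0$ for every $j$ (equivalently, both $U$ and $U'$ are potentials). *)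

theory Defs
  imports "HOL-Analysis.Analysis"
begin

definition nonneg_matrix :: "real ^ 'n ^ 'n \<Rightarrow> bool" where
  "nonneg_matrix A \<longleftrightarrow> (\<forall>i j. 0 \<le> A $ i $ j)"

definition M_matrix :: "real ^ 'n ^ 'n \<Rightarrow> bool" where
  "M_matrix M \<longleftrightarrow>
     invertible M \<and> (\<forall>i j. i \<noteq> j \<longrightarrow> M $ i $ j \<le> 0) \<and> nonneg_matrix (matrix_inv M)"

definition inverse_M_matrix :: "real ^ 'n ^ 'n \<Rightarrow> bool" where
  "inverse_M_matrix U \<longleftrightarrow> (\<exists>M. M_matrix M \<and> U = matrix_inv M)"

definition potential :: "real ^ 'n ^ 'n \<Rightarrow> bool" where
  "potential U \<longleftrightarrow>
     nonneg_matrix U \<and> invertible U \<and>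
     (\<forall>i j. i \<noteq> j \<longrightarrow> matrix_inv U $ i $ j \<le> 0) \<and>
     (\<forall>i. 0 < matrix_inv U $ i $ i) \<and>
     (\<forall>i. 0 \<le> (\<Sum>j\<in>UNIV. matrix_inv U $ i $ j))"

definition bi_potential :: "real ^ 'n ^ 'n \<Rightarrow> bool" where
  "bi_potential U \<longleftrightarrow>
     potential U \<and> (\<forall>j. 0 \<le> (\<Sum>i\<in>UNIV. matrix_inv U $ i $ j))"

(* Entrywise power. It is only meant for nonnegative matrices and positive exponents,
   where powr is the usual real power; in particular 0 powr a = 0. *)
definition hadamard_power :: "real ^ 'n ^ 'n \<Rightarrow> real \<Rightarrow> real ^ 'n ^ 'n" where
  "hadamard_power U a = (\<chi> i j. (U $ i $ j) powr a)"

end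

theory Submission
  imports Defs
begin

text \<open>
  Let \<open>M = U\<^sup>-\<^sup>1\<close>, let \<open>W\<close> be the entrywise power \<open>U\<^sup>\<alpha>\<close>, let \<open>\<lambda> > 0\<close> and \<open>v = U \<lambda>\<close>. Convexity of
  \<open>t \<mapsto> t\<^sup>\<alpha>\<close> shows that \<open>Z = M diag(v)\<^sup>1\<^sup>-\<^sup>\<alpha> W\<close> has nonpositive off-diagonal entries, and
  \<open>w\<^sup>T Z > 0\<close> for \<open>w = U\<^sup>T 1 > 0\<close>, so \<open>Z x \<ge> 0\<close> implies \<open>x \<ge> 0\<close>. Hence \<open>W\<close> is
  invertible, and \<open>W x = v\<^sup>\<alpha>\<close> implies \<open>Z x = M v = \<lambda> \<ge> 0\<close> and thus \<open>x \<ge> 0\<close>; by continuity this persists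
  for \<open>\<lambda> \<ge> 0\<close>. Taking \<open>v = 1\<close> gives the row sums of \<open>W\<^sup>-\<^sup>1\<close>. Taking \<open>v = U e\<^sub>j - e\<^sub>j / M\<^sub>j\<^sub>j\<close> gives
  \<open>0 \<le> W\<^sup>-\<^sup>1 v\<^sup>\<alpha> = e\<^sub>j - \<delta> W\<^sup>-\<^sup>1 e\<^sub>j\<close> with \<open>\<delta> > 0\<close>, hence the signs off the diagonal.
\<close>

section \<open>Tools: convexity of the power and matrices with nonpositive off-diagonal
  entries\<close>

lemma powr_ge_tangent:
  fixes r s a :: real
  assumes "0 \<le> r" "0 \<le> s" "1 \<le> a"
  shows "s powr a + a * s powr (a - 1) * (r - s) \<le> r powr a"
proof (cases "r = 0 \<or> s = 0")
  case True
  \<comment> \<open>Convexity is used below on the open half-line, so the boundary is treated here.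
    At r = 0 the claim is (1 - a) s^a \<le> 0; at s = 0 the left side vanishes, since
    \<open>0 powr b = 0\<close> even for b = 0.\<close>
  have "s powr a + a * s powr (a - 1) * (0 - s) = (1 - a) * s powr a"
    using assms by (cases "s = 0") (auto simp: powr_diff algebra_simps)
  then show ?thesis
    using True assms by (auto simp: mult_nonpos_nonneg)
next
  case False
  with assms have pos: "0 < r" "0 < s" by simp_all
  have "a * s powr (a - 1) * (r - s) \<le> r powr a - s powr a"
  proof (rule convex_on_imp_above_tangent[OF powr_convex[OF \<open>1 \<le> a\<close>]])
    show "((\<lambda>x. x powr a) has_real_derivative a * s powr (a - 1)) (at s within {0<..})"
      using pos by (auto intro!: derivative_eq_intros simp: powr_diff)
  qed (use pos in \<open>auto simp: connected_Ioi interior_open\<close>)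
  then show ?thesis by simp
qed

text \<open>Sum the rows of Zx over the set S of negative coordinates, with weights w. The
  coefficient \<open>c j\<close> of x_j is positive on S, since the rows left out only lower the
  positive sum (wZ)_j, and nonpositive off S. If S were nonempty, this sum of nonnegative terms
  would be negative.\<close>

lemma Z_matrix_monotone:
  fixes Z :: "real ^ 'n ^ 'n" and w x :: "real ^ 'n"
  assumes Z: "\<And>i j. i \<noteq> j \<Longrightarrow> Z $ i $ j \<le> 0"
    and w: "\<And>i. 0 < w $ i"
    and wZ: "\<And>j. 0 < (w v* Z) $ j"
    and Zx: "\<And>i. 0 \<le> (Z *v x) $ i"
  shows "0 \<le> x $ k"
proof (rule ccontr)
  define S where "S = {i. x $ i < 0}"
  define c where "c j = (\<Sum>i\<in>S. w $ i * Z $ i $ j)" for j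
  assume "\<not> 0 \<le> x $ k"
  then have k: "k \<in> S" by (simp add: S_def)
  have neg: "c j * x $ j < 0" if "j \<in> S" for j
  proof -
    have "(\<Sum>i\<in>UNIV. w $ i * Z $ i $ j) \<le> c j"
    proof -
      have "(\<Sum>i\<in>UNIV. w $ i * Z $ i $ j) = c j + (\<Sum>i\<in>-S. w $ i * Z $ i $ j)"
        unfolding c_def by (subst sum.union_disjoint[symmetric]) auto
      moreover have "(\<Sum>i\<in>-S. w $ i * Z $ i $ j) \<le> 0"
        using that by (intro sum_nonpos mult_nonneg_nonpos Z) (auto simp: less_imp_le[OF w])
      ultimately show ?thesis by simp
    qed
    then have "0 < c j"
      using wZ[of j] by (simp add: vector_matrix_mult_def mult.commute)
    then show ?thesis using that by (simp add: S_def mult_pos_neg)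
  qed
  have nonpos: "c j * x $ j \<le> 0" for j
  proof (cases "j \<in> S")
    case False
    then have "c j \<le> 0"
      unfolding c_def using False by (intro sum_nonpos mult_nonneg_nonpos Z) (auto simp: less_imp_le[OF w])
    then show ?thesis using False by (simp add: S_def mult_nonpos_nonneg)
  qed (use neg in \<open>simp add: less_imp_le\<close>)
  have "(\<Sum>i\<in>S. w $ i * (Z *v x) $ i) = (\<Sum>j\<in>UNIV. c j * x $ j)"
    unfolding c_def matrix_vector_mult_def
    by (simp add: sum_distrib_left sum_distrib_right mult.assoc) (rule sum.swap)
  also have "\<dots> < 0"
    using sum_strict_mono_ex1[of UNIV "\<lambda>j. c j * x $ j" "\<lambda>_. 0"] nonpos neg[OF k] by auto
  finally show False
    using sum_nonneg[of S "\<lambda>i. w $ i * (Z *v x) $ i"] w Zx by (auto simp: less_imp_le not_less)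
qed

text \<open>In (AB)_ii = 1 all terms but A_ii B_ii are nonpositive. It serves both for M and for the
  inverse of the power.\<close>

lemma Z_matrix_inverse_diag_pos:
  fixes A B :: "real ^ 'n ^ 'n"
  assumes AB: "A ** B = mat 1"
    and B: "\<And>i j. 0 \<le> B $ i $ j"
    and A: "\<And>i j. i \<noteq> j \<Longrightarrow> A $ i $ j \<le> 0"
  shows "0 < A $ i $ i"
proof -
  have "1 = (A ** B) $ i $ i" by (simp add: AB mat_def)
  also have "\<dots> = A $ i $ i * B $ i $ i + (\<Sum>k\<in>UNIV - {i}. A $ i $ k * B $ k $ i)"
    unfolding matrix_matrix_mult_def by (simp add: sum.remove[of UNIV i])
  also have "(\<Sum>k\<in>UNIV - {i}. A $ i $ k * B $ k $ i) \<le> 0"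
    using B A by (intro sum_nonpos mult_nonpos_nonneg) auto
  finally show ?thesis using B[of i i] by (smt (verit) mult_nonpos_nonneg)
qed

section \<open>Monotonicity, invertibility and the inverse of the entrywise power\<close>

lemma hadamard_power_monotone:
  fixes U M :: "real ^ 'n ^ 'n" and l x :: "real ^ 'n"
  assumes MU: "M ** U = mat 1"
    and U: "\<And>i j. 0 \<le> U $ i $ j"
    and M: "\<And>i j. i \<noteq> j \<Longrightarrow> M $ i $ j \<le> 0"
    and l: "\<And>i. 0 < l $ i" and a: "1 \<le> a"
    and x: "\<And>i. 0 \<le> (M *v (\<chi> k. (U *v l) $ k powr (1 - a) * (hadamard_power U a *v x) $ k)) $ i"
  shows "0 \<le> x $ k"
proof -
  have UM: "U ** M = mat 1" using MU by (simp add: matrix_left_right_inverse)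
  define v where "v = U *v l"
  have Mv: "M *v v = l" by (simp add: v_def matrix_vector_mul_assoc MU)
  \<comment> \<open>A nonsingular U has no zero row or column; this makes v and w strictly positive,
    so negative powers of v and division by v are safe.\<close>
  have row: "\<exists>j. 0 < U $ i $ j" for i
  proof (rule ccontr)
    assume "\<not> ?thesis"
    with U have "U $ i $ j = 0" for j by (auto simp: not_less order.antisym)
    then have "(U ** M) $ i $ i = 0" by (simp add: matrix_matrix_mult_def)
    with UM show False by (simp add: mat_def)
  qed
  have col: "\<exists>i. 0 < U $ i $ j" for j
  proof (rule ccontr)
    assume "\<not> ?thesis"
    with U have "U $ i $ j = 0" for i by (auto simp: not_less order.antisym)
    then have "(M ** U) $ j $ j = 0" by (simp add: matrix_matrix_mult_def)
    with MU show False by (simp add: mat_def)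
  qed
  have v: "0 < v $ i" for i
  proof -
    obtain j where "0 < U $ i $ j" using row by blast
    then show ?thesis
      using U l by (auto simp: v_def matrix_vector_mult_def less_imp_le intro!: sum_pos2[of _ j])
  qed
  \<comment> \<open>Chosen so that w M is the all-ones row: then w (M V) is the row of column sums
    of V, which is nonnegative and has no zero column.\<close>
  define w where "w = (1 :: real ^ 'n) v* U"
  have w: "0 < w $ i" for i
  proof -
    obtain k where "0 < U $ k $ i" using col by blast
    then show ?thesis
      using U by (auto simp: w_def vector_matrix_mult_def intro!: sum_pos2[of _ k])
  qed
  define W where "W = hadamard_power U a"
  define V where "V = (\<chi> k j. v $ k powr (1 - a) * W $ k $ j)"
  have V: "V *v y = (\<chi> k. v $ k powr (1 - a) * (W *v y) $ k)" for y
    by (simp add: V_def matrix_vector_mult_def vec_eq_iff sum_distrib_left mult.assoc)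
  show ?thesis
  proof (rule Z_matrix_monotone[of "M ** V" w])
    show "0 < w $ i" for i by (rule w)
    show "0 \<le> ((M ** V) *v x) $ i" for i
      using x by (simp add: matrix_vector_mul_assoc[symmetric] V v_def W_def)
    show "0 < (w v* (M ** V)) $ j" for j
    proof -
      have "w v* (M ** V) = 1 v* V"
        by (simp add: w_def vector_matrix_mul_assoc matrix_mul_assoc UM)
      moreover obtain k where "0 < U $ k $ j" using col by blast
      then have "0 < V $ k $ j"
        using v[of k] by (simp add: V_def W_def hadamard_power_def)
      moreover have "0 \<le> V $ i $ j" for i
        by (simp add: V_def W_def hadamard_power_def)
      ultimately show ?thesis
        by (auto simp: vector_matrix_mult_def intro!: sum_pos2[of _ k])
    qed
    show "(M ** V) $ i $ j \<le> 0" if ij: "i \<noteq> j" for i j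
    proof -
      \<comment> \<open>Then V_kj = v_k r_k^a, while v_k r_k = U_kj. The tangent is taken at s =
        r_i: both sides agree for k = i, and for k \<noteq> i the factor M_ik v_k \<le> 0 reverses
        the tangent inequality.\<close>
      define r where "r k = U $ k $ j / v $ k" for k
      define s where "s = r i"
      have r: "0 \<le> r k" for k using U v by (simp add: r_def less_imp_le)
      have "(M ** V) $ i $ j = (\<Sum>k\<in>UNIV. M $ i $ k * v $ k * r k powr a)"
        using v U
        by (auto simp: matrix_matrix_mult_def V_def W_def hadamard_power_def r_def powr_divide
            powr_diff less_imp_le mult.assoc intro!: sum.cong)
      also have "\<dots> \<le> (\<Sum>k\<in>UNIV. M $ i $ k * v $ k * (s powr a + a * s powr (a - 1) * (r k - s)))"
      proof (rule sum_mono)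
        fix k
        show "M $ i $ k * v $ k * r k powr a
            \<le> M $ i $ k * v $ k * (s powr a + a * s powr (a - 1) * (r k - s))"
        proof (cases "k = i")
          case False
          then have "M $ i $ k * v $ k \<le> 0"
            using M v by (simp add: mult_nonpos_nonneg less_imp_le)
          then show ?thesis
            using powr_ge_tangent[OF r r a] by (intro mult_left_mono_neg) (simp_all add: s_def)
        qed (simp add: s_def)
      qed
      \<comment> \<open>Since M v = l and (MU)_ij = 0, only l_i (1 - a) s^a \<le> 0 survives of the
        linear bound.\<close>
      also have "\<dots> = (\<Sum>k\<in>UNIV. M $ i $ k * v $ k) * (s powr a - a * s powr (a - 1) * s)
          + (\<Sum>k\<in>UNIV. M $ i $ k * (v $ k * r k)) * (a * s powr (a - 1))"
        by (simp add: algebra_simps sum.distrib sum_subtractf sum_distrib_left sum_distrib_right)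
      also have "(\<Sum>k\<in>UNIV. M $ i $ k * v $ k) = l $ i"
        using Mv by (metis matrix_vector_mul_component inner_vec_def inner_real_def sum.cong)
      also have "(\<Sum>k\<in>UNIV. M $ i $ k * (v $ k * r k)) = (M ** U) $ i $ j"
        using v by (simp add: matrix_matrix_mult_def r_def less_imp_neq[THEN not_sym])
      also have "\<dots> = 0" using ij by (simp add: MU mat_def)
      also have "s powr a - a * s powr (a - 1) * s = (1 - a) * s powr a"
        using r[of i] by (cases "s = 0") (auto simp: s_def powr_diff algebra_simps)
      finally show ?thesis
        using l[of i] a by (smt (verit) mult_nonneg_nonneg mult_nonpos_nonneg mult_nonneg_nonpos
            powr_ge_zero mult_zero_left)
    qed
  qed
qed

text \<open>Monotonicity with l = 1 makes every kernel vector nonnegative; applied to x and -x it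
  gives a trivial kernel.\<close>

lemma invertible_hadamard_power:
  fixes U M :: "real ^ 'n ^ 'n"
  assumes MU: "M ** U = mat 1"
    and U: "\<And>i j. 0 \<le> U $ i $ j"
    and M: "\<And>i j. i \<noteq> j \<Longrightarrow> M $ i $ j \<le> 0"
    and a: "1 \<le> a"
  shows "invertible (hadamard_power U a)"
proof -
  have "x = 0" if x: "hadamard_power U a *v x = 0" for x
  proof -
    have *: "0 \<le> y $ k" if "hadamard_power U a *v y = 0" for y k
    proof (rule hadamard_power_monotone[OF MU U M _ a, where l = 1])
      have "(\<chi> k. (U *v 1) $ k powr (1 - a) * (hadamard_power U a *v y) $ k) = 0"
        by (simp add: that vec_eq_iff)
      then show "0 \<le> (M *v (\<chi> k. (U *v 1) $ k powr (1 - a) * (hadamard_power U a *v y) $ k)) $ i" for i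
        by simp
    qed auto
    have "hadamard_power U a *v (- x) = 0"
      using x by (simp add: matrix_vector_mult_def vec_eq_iff sum_negf)
    then have "x $ k = 0" for k
      using *[OF x, of k] *[of "- x" k] by simp
    then show ?thesis by (simp add: vec_eq_iff)
  qed
  then show ?thesis
    by (metis invertible_left_inverse matrix_left_invertible_ker)
qed

text \<open>For x = N v^a with v = U l, the rescaled product v^(1-a) (W x) is v itself, which M
  sends to l; monotonicity then gives x \<ge> 0.\<close>

lemma hadamard_power_inverse_excessive:
  fixes U M N :: "real ^ 'n ^ 'n" and l :: "real ^ 'n"
  assumes MU: "M ** U = mat 1"
    and U: "\<And>i j. 0 \<le> U $ i $ j"
    and M: "\<And>i j. i \<noteq> j \<Longrightarrow> M $ i $ j \<le> 0"
    and a: "1 \<le> a"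
    and WN: "hadamard_power U a ** N = mat 1"
    and l: "\<And>i. 0 \<le> l $ i"
  shows "0 \<le> (N *v (\<chi> k. (U *v l) $ k powr a)) $ i"
proof -
  have pos: "0 \<le> (N *v (\<chi> k. (U *v m) $ k powr a)) $ i"
    if m: "\<And>i. 0 < m $ i" for m :: "real ^ 'n"
  proof (rule hadamard_power_monotone[OF MU U M m a])
    fix i
    have nonneg: "0 \<le> (U *v m) $ k" for k
      using U m by (auto simp: matrix_vector_mult_def less_imp_le intro!: sum_nonneg)
    have "(\<chi> k. (U *v m) $ k powr (1 - a) *
        (hadamard_power U a *v (N *v (\<chi> k. (U *v m) $ k powr a))) $ k) = U *v m"
      using nonneg by (simp add: matrix_vector_mul_assoc WN vec_eq_iff powr_add[symmetric])
    then show "0 \<le> (M *v (\<chi> k. (U *v m) $ k powr (1 - a) *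
        (hadamard_power U a *v (N *v (\<chi> k. (U *v m) $ k powr a))) $ k)) $ i"
      using m by (simp add: matrix_vector_mul_assoc MU less_imp_le)
  qed
  \<comment> \<open>Monotonicity asks for strictly positive l, so l is shifted by e > 0 and e tends
    to 0 from the right. Entries of U l may vanish in the limit; the power is still continuous there
    because a > 0 and the bases stay nonnegative.\<close>
  define f where "f e = (N *v (\<chi> k. (U *v (l + e *\<^sub>R 1)) $ k powr a)) $ i" for e :: real
  have nonneg: "0 \<le> (U *v (l + e *\<^sub>R 1)) $ k" if "0 \<le> e" for e k
    using U l that by (auto simp: matrix_vector_mult_def intro!: sum_nonneg)
  have "((\<lambda>e. (U *v (l + e *\<^sub>R 1)) $ k powr a) \<longlongrightarrow> (U *v (l + 0 *\<^sub>R 1)) $ k powr a) (at_right 0)" for k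
  proof (rule tendsto_powr2)
    show "((\<lambda>e. (U *v (l + e *\<^sub>R 1)) $ k) \<longlongrightarrow> (U *v (l + 0 *\<^sub>R 1)) $ k) (at_right 0)"
      unfolding matrix_vector_mult_def by (auto intro!: tendsto_eq_intros)
    show "\<forall>\<^sub>F e in at_right 0. 0 \<le> (U *v (l + e *\<^sub>R 1)) $ k"
      using nonneg by (auto simp: eventually_at_right_less intro: eventually_mono[OF eventually_at_right_less])
  qed (use a in auto)
  then have "(f \<longlongrightarrow> f 0) (at_right 0)"
    unfolding f_def matrix_vector_mult_def[of N] vec_lambda_beta
    by (intro tendsto_sum tendsto_mult tendsto_const)
  moreover have "\<forall>\<^sub>F e in at_right 0. 0 \<le> f e"
    unfolding f_def
    by (intro eventually_mono[OF eventually_at_right_less] pos) (use l in \<open>simp add: add_nonneg_pos\<close>)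
  ultimately have "0 \<le> f 0"
    by (rule tendsto_lowerbound) simp
  then show ?thesis by (simp add: f_def)
qed

lemma hadamard_power_inverse_offdiag:
  fixes U M N :: "real ^ 'n ^ 'n"
  assumes MU: "M ** U = mat 1"
    and U: "\<And>i j. 0 \<le> U $ i $ j"
    and M: "\<And>i j. i \<noteq> j \<Longrightarrow> M $ i $ j \<le> 0"
    and a: "1 \<le> a"
    and WN: "hadamard_power U a ** N = mat 1"
    and ij: "i \<noteq> j"
  shows "N $ i $ j \<le> 0"
proof -
  have UM: "U ** M = mat 1" using MU by (simp add: matrix_left_right_inverse)
  have NW: "N ** hadamard_power U a = mat 1" using WN by (simp add: matrix_left_right_inverse)
  have d: "0 < M $ j $ j" by (rule Z_matrix_inverse_diag_pos[OF MU U M])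
  \<comment> \<open>The factor 1 / M_jj is the largest that keeps l nonnegative: entry j becomes 0
    and the others are -M_kj / M_jj.\<close>
  define l where "l = (axis j 1 :: real ^ 'n) - (1 / M $ j $ j) *\<^sub>R column j M"
  have l: "0 \<le> l $ k" for k
    using d M[of k j] by (cases "k = j") (auto simp: l_def axis_def column_def divide_nonpos_pos)
  have UMj: "U *v column j M = axis j 1"
    by (metis UM matrix_vector_mul_assoc matrix_vector_mul_lid matrix_vector_mult_basis)
  have Ul: "U *v l = column j U - (1 / M $ j $ j) *\<^sub>R axis j 1"
    by (simp add: l_def matrix_vector_mult_diff_distrib matrix_vector_mult_scaleR UMj
        matrix_vector_mult_basis)
  define v where "v = U *v l"
  define c where "c = U $ j $ j powr a - v $ j powr a"
  have "0 \<le> v $ j"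
    using U l by (auto simp: v_def matrix_vector_mult_def intro!: sum_nonneg)
  moreover have "v $ j < U $ j $ j"
    using d by (simp add: v_def Ul column_def axis_def)
  ultimately have c: "0 < c"
    using a by (simp add: c_def powr_less_mono2)
  have NWj: "N *v column j (hadamard_power U a) = axis j 1"
    by (metis NW matrix_vector_mul_assoc matrix_vector_mul_lid matrix_vector_mult_basis)
  \<comment> \<open>\<open>U *v l\<close> differs from column j of U only in entry j, so the powers
    also differ only there, by the gap c > 0.\<close>
  have "(\<chi> k. v $ k powr a) = column j (hadamard_power U a) - c *\<^sub>R axis j 1"
    by (auto simp: vec_eq_iff c_def v_def Ul column_def hadamard_power_def axis_def)
  then have "N *v (\<chi> k. v $ k powr a) = axis j 1 - c *\<^sub>R column j N"
    by (simp only: matrix_vector_mult_diff_distrib matrix_vector_mult_scaleR NWj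
        matrix_vector_mult_basis)
  then have "0 \<le> - c * N $ i $ j"
    using hadamard_power_inverse_excessive[OF MU U M a WN l, of i] ij
    by (simp add: v_def axis_def column_def)
  then show ?thesis using c by (simp add: mult_le_0_iff)
qed

section \<open>Assembly: signs, row sums and column sums of the inverse\<close>

lemma matrix_inv_eqI:
  fixes A B :: "real ^ 'n ^ 'n"
  assumes "A ** B = mat 1"
  shows "matrix_inv A = B"
proof -
  have "B ** A = mat 1" using assms by (simp add: matrix_left_right_inverse)
  then have "A ** matrix_inv A = mat 1"
    unfolding matrix_inv_def using assms by (rule_tac someI2) auto
  then have "B ** (A ** matrix_inv A) = B" by simp
  then show ?thesis by (simp add: matrix_mul_assoc \<open>B ** A = mat 1\<close>)
qed

theorem theorem2p2:
  fixes U :: "real ^ 'n ^ 'n" and \<alpha> :: real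
  assumes "inverse_M_matrix U" and "1 \<le> \<alpha>"
  shows "inverse_M_matrix (hadamard_power U \<alpha>) \<and>
         (potential U \<longrightarrow> potential (hadamard_power U \<alpha>)) \<and>
         (bi_potential U \<longrightarrow> bi_potential (hadamard_power U \<alpha>))"
proof -
  obtain M where M: "M_matrix M" and UM: "U = matrix_inv M"
    using assms(1) unfolding inverse_M_matrix_def by blast
  have MU: "M ** U = mat 1"
    using M UM by (metis M_matrix_def invertible_def matrix_inv_eqI)
  then have Uinv: "matrix_inv U = M"
    by (simp add: matrix_inv_eqI matrix_left_right_inverse)
  have U: "0 \<le> U $ i $ j" for i j
    using M UM by (simp add: M_matrix_def nonneg_matrix_def)
  have Moff: "M $ i $ j \<le> 0" if "i \<noteq> j" for i j
    using M that by (simp add: M_matrix_def)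
  define W where "W = hadamard_power U \<alpha>"
  define N where "N = matrix_inv W"
  have W: "0 \<le> W $ i $ j" for i j by (simp add: W_def hadamard_power_def)
  have inv: "invertible W"
    unfolding W_def by (rule invertible_hadamard_power[OF MU U Moff assms(2)])
  have WN: "W ** N = mat 1" and NW: "N ** W = mat 1"
    using inv by (metis N_def invertible_def matrix_inv_eqI)+
  have Noff: "N $ i $ j \<le> 0" if "i \<noteq> j" for i j
    by (rule hadamard_power_inverse_offdiag[OF MU U Moff assms(2) WN[unfolded W_def] that])
  have Ndiag: "0 < N $ i $ i" for i
    by (rule Z_matrix_inverse_diag_pos[OF NW W Noff])
  have row: "0 \<le> (\<Sum>j\<in>UNIV. N $ i $ j)" if "\<And>i. 0 \<le> (\<Sum>j\<in>UNIV. M $ i $ j)" for i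
  proof -
    \<comment> \<open>The row sums of M form l = M 1, so the hypothesis says l \<ge> 0; here U l = 1
      and all its powers are 1.\<close>
    have "U *v (M *v 1) = 1"
      using MU matrix_left_right_inverse[of M U] by (simp add: matrix_vector_mul_assoc)
    moreover have "0 \<le> (M *v 1) $ i" for i
      using that by (simp add: matrix_vector_mult_def)
    ultimately show ?thesis
      using hadamard_power_inverse_excessive[OF MU U Moff assms(2) WN[unfolded W_def], of "M *v 1" i]
      by (simp add: matrix_vector_mult_def)
  qed
  have col: "0 \<le> (\<Sum>i\<in>UNIV. N $ i $ j)" if "\<And>j. 0 \<le> (\<Sum>i\<in>UNIV. M $ i $ j)" for j
  proof -
    \<comment> \<open>Column sums are the row sums of the transposes, and transposition commutes
      with the entrywise power.\<close>
    have MU': "transpose M ** transpose U = mat 1"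
      using MU by (metis matrix_left_right_inverse matrix_transpose_mul transpose_mat)
    have WN': "hadamard_power (transpose U) \<alpha> ** transpose N = mat 1"
    proof -
      have "hadamard_power (transpose U) \<alpha> = transpose W"
        by (simp add: W_def hadamard_power_def transpose_def vec_eq_iff)
      then show ?thesis using NW by (metis matrix_transpose_mul transpose_mat)
    qed
    have "transpose U *v (transpose M *v 1) = 1"
      using MU' matrix_left_right_inverse[of "transpose M" "transpose U"]
      by (simp add: matrix_vector_mul_assoc del: transpose_matrix_vector)
    moreover have "0 \<le> (transpose M *v 1) $ i" for i
      using that by (simp add: vector_matrix_mult_def)
    moreover have "0 \<le> transpose U $ i $ j" "i \<noteq> j \<Longrightarrow> transpose M $ i $ j \<le> 0" for i j
      using U Moff by (simp_all add: transpose_def)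
    ultimately show ?thesis
      using hadamard_power_inverse_excessive[OF MU' _ _ assms(2) WN', of "transpose M *v 1" j]
      by (simp add: vector_matrix_mult_def del: transpose_matrix_vector)
        (simp add: matrix_vector_mult_def transpose_def)
  qed
  have "inverse_M_matrix W"
    unfolding inverse_M_matrix_def M_matrix_def nonneg_matrix_def
    using matrix_inv_eqI[OF NW] W Noff NW WN by (metis invertible_def)
  moreover have "potential W" if "potential U"
    using that row Noff Ndiag W inv
    by (auto simp: potential_def Uinv nonneg_matrix_def N_def[symmetric])
  ultimately show ?thesis
    using col by (auto simp: bi_potential_def Uinv N_def[symmetric] W_def[symmetric])
qed

end
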